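(* The group $\mathrm{FSym}(\mathbb{N})$ of all finitary permutations of $\mathbb{N}$ is not interspersed-finite solvable.
   Context: A finitary permutation of $\mathbb{N}$ is a bijection $\mathbb{N}\to\mathbb{N}$ that is the identity outside a finite set. A group $G$ is interspersed-finite solvable if there is a finite series of subgroups $\{e\}=G_r\subset G_{r-1}\subset\dots\subset G_1\subset G_0=G$ such that for each $k\in\{0,1,\dots,r-1\}$ the subgroup $G_{k+1}$ is normal in $G_k$ and the quotient group $G_k/G_{k+1}$ is either abelian or finite. *)

theory Defs
  imports "HOL-Algebra.Sym_Groups"
begin

definition FSym :: "(nat \<Rightarrow> nat) monoid"
  where "FSym = \<lparr>carrier = {f. bij f \<and> finite {n. f n \<noteq> n}}, mult = (\<circ>), one = id\<rparr>"

lemma group_FSym: "group FSym"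
proof (rule groupI)
  fix f g assume "f \<in> carrier FSym" "g \<in> carrier FSym"
  then have fg: "bij f" "bij g" "finite ({n. f n \<noteq> n} \<union> {n. g n \<noteq> n})"
    by (auto simp: FSym_def)
  have "{n. (f \<circ> g) n \<noteq> n} \<subseteq> {n. f n \<noteq> n} \<union> {n. g n \<noteq> n}"
    by auto
  then have "finite {n. (f \<circ> g) n \<noteq> n}"
    using fg(3) by (rule finite_subset)
  then show "f \<otimes>\<^bsub>FSym\<^esub> g \<in> carrier FSym"
    using fg by (simp add: FSym_def bij_comp)
next
  fix f assume "f \<in> carrier FSym"
  then have f: "bij f" "finite {n. f n \<noteq> n}"
    by (auto simp: FSym_def)
  let ?g = "inv' f"
  have "{n. ?g n \<noteq> n} = {n. f n \<noteq> n}"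
    using f(1) by (metis bij_inv_eq_iff)
  then have "?g \<in> carrier FSym"
    using f by (simp add: FSym_def bij_imp_bij_inv)
  moreover have "?g \<otimes>\<^bsub>FSym\<^esub> f = \<one>\<^bsub>FSym\<^esub>"
    using f(1) by (simp add: FSym_def bij_is_inj)
  ultimately show "\<exists>g\<in>carrier FSym. g \<otimes>\<^bsub>FSym\<^esub> f = \<one>\<^bsub>FSym\<^esub>" by blast
qed (auto simp: FSym_def)

text \<open>
  Consecutive terms of the series may coincide: inclusions are not required to be strict.
  As in \<open>solvable_seq\<close>, a subgroup \<open>S k\<close> is regarded as a group by restricting the carrier of \<open>G\<close>.
\<close>

definition interspersed_finite_solvable :: "('a, 'b) monoid_scheme \<Rightarrow> bool"
  where "interspersed_finite_solvable G \<longleftrightarrow>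
    (\<exists>(r :: nat) (S :: nat \<Rightarrow> 'a set).
      S 0 = carrier G \<and> S r = {\<one>\<^bsub>G\<^esub>} \<and>
      (\<forall>k\<le>r. subgroup (S k) G) \<and>
      (\<forall>k<r. S (Suc k) \<lhd> (G\<lparr>carrier := S k\<rparr>) \<and>
        (comm_group ((G\<lparr>carrier := S k\<rparr>) Mod S (Suc k)) \<or>
         finite (carrier ((G\<lparr>carrier := S k\<rparr>) Mod S (Suc k))))))"

end

(*
  Every term of the series contains all 3-cycles. This passes from one term G_k to the next,
  G_(k+1). In the abelian case, each 3-cycle is a commutator of two 3-cycles. In the finite case,
  two of the infinitely many 3-cycles (p n q) lie in the same coset, so their quotient, again a
  3-cycle, lies in G_(k+1); conjugating by 3-cycles moves it to any prescribed 3-cycle.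
*)
theory Submission
  imports Defs
begin

lemma (in group) rcos_eq_imp_mult_inv_mem:
  assumes "subgroup H G" "x \<in> carrier G" "y \<in> carrier G" "H #> x = H #> y"
  shows "x \<otimes> inv y \<in> H"
  using assms subgroup.rcos_module_imp[OF assms(1) is_group, of y x] rcos_self[of x H] by simp

text \<open>As the quotient is abelian, \<open>x \<otimes> y\<close> and
  \<open>y \<otimes> x\<close> lie in the same coset; dividing one by the other leaves the
  commutator.\<close>

lemma (in normal) commutator_mem_of_comm_group_Mod:
  assumes "comm_group (G Mod H)" "x \<in> carrier G" "y \<in> carrier G"
  shows "x \<otimes> y \<otimes> inv x \<otimes> inv y \<in> H"
proof -
  interpret Q: comm_group "G Mod H" by fact
  have "H #> x \<in> carrier (G Mod H)" "H #> y \<in> carrier (G Mod H)"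
    using assms by (auto simp: FactGroup_def RCOSETS_def)
  then have "(H #> x) <#> (H #> y) = (H #> y) <#> (H #> x)"
    using Q.m_comm by (simp add: FactGroup_def)
  then have "H #> (x \<otimes> y) = H #> (y \<otimes> x)"
    using assms by (simp add: rcos_sum)
  then have "(x \<otimes> y) \<otimes> inv (y \<otimes> x) \<in> H"
    using assms by (intro rcos_eq_imp_mult_inv_mem) (auto intro: subgroup_axioms)
  then show ?thesis
    using assms by (simp add: inv_mult_group m_assoc)
qed

text \<open>Pigeonhole: infinitely many indices are mapped to finitely many cosets, so two distinct
  indices share one.\<close>

lemma (in normal) finite_Mod_imp_quotient_mem:
  assumes "finite (carrier (G Mod H))" "infinite A" "f ` A \<subseteq> carrier G"
  obtains m n where "m \<in> A" "n \<in> A" "m \<noteq> n" "f m \<otimes> inv (f n) \<in> H"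
proof -
  have "(\<lambda>n. H #> f n) ` A \<subseteq> carrier (G Mod H)"
    using assms by (auto simp: FactGroup_def RCOSETS_def)
  then have "\<not> inj_on (\<lambda>n. H #> f n) A"
    using assms by (meson finite_imageD finite_subset)
  then obtain m n where "m \<in> A" "n \<in> A" "m \<noteq> n" "H #> f m = H #> f n"
    by (auto simp: inj_on_def)
  with assms(3) show ?thesis
    by (intro that) (auto intro!: rcos_eq_imp_mult_inv_mem subgroup_axioms)
qed

definition cyc :: "'a \<Rightarrow> 'a \<Rightarrow> 'a \<Rightarrow> 'a \<Rightarrow> 'a"
  where "cyc a b c = id(a := b, b := c, c := a)"

lemma cyc_comp_rev:
  "distinct [a, b, c] \<Longrightarrow> cyc a b c \<circ> cyc c b a = id"
  by (auto simp: cyc_def fun_eq_iff)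

lemma mult_FSym: "f \<otimes>\<^bsub>FSym\<^esub> g = f \<circ> g"
  by (simp add: FSym_def)

lemma cyc_in_FSym:
  assumes "distinct [a, b, c]"
  shows "cyc a b c \<in> carrier FSym"
proof -
  have "bij (cyc a b c)"
    using assms by (intro o_bij[of "cyc c b a"]) (auto intro: cyc_comp_rev)
  moreover have "{n. cyc a b c n \<noteq> n} \<subseteq> {a, b, c}"
    by (auto simp: cyc_def)
  ultimately show ?thesis
    by (auto simp: FSym_def intro: finite_subset)
qed

lemma inv_cyc:
  assumes "distinct [a, b, c]"
  shows "inv\<^bsub>FSym\<^esub> (cyc a b c) = cyc c b a"
proof (rule group.inv_equality[OF group_FSym])
  show "cyc c b a \<otimes>\<^bsub>FSym\<^esub> cyc a b c = \<one>\<^bsub>FSym\<^esub>"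
    using assms cyc_comp_rev[of c b a] by (auto simp: FSym_def)
qed (use assms in \<open>auto intro: cyc_in_FSym\<close>)

text \<open>Conjugation relabels the entries of a cycle: \<open>cyc b d e\<close> sends
  \<open>b\<close> to \<open>d\<close> and fixes \<open>a\<close> and \<open>c\<close>.\<close>

lemma cyc_conj:
  assumes "distinct [a, b, c, d, e]"
  shows "cyc b d e \<circ> cyc a b c \<circ> cyc e d b = cyc a d c"
  using assms by (auto simp: cyc_def fun_eq_iff)

lemma cyc_rotate:
  "distinct [a, b, c] \<Longrightarrow> cyc a b c = cyc b c a"
  by (auto simp: cyc_def fun_eq_iff)

text \<open>The last two factors are the inverses of the first two. Two 3-cycles that meet in the
  single point \<open>a\<close> have as commutator a 3-cycle on \<open>a\<close> and its two images
  \<open>b\<close> and \<open>c\<close>.\<close>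

lemma cyc_commutator:
  assumes "distinct [a, b, c, d, e]"
  shows "cyc a b d \<circ> cyc a c e \<circ> cyc d b a \<circ> cyc e c a = cyc a b c"
  using assms by (auto simp: cyc_def fun_eq_iff)

text \<open>The second factor is the inverse of \<open>cyc p n q\<close>. Both
  \<open>cyc p m q\<close> and \<open>cyc p n q\<close> send \<open>q\<close> to \<open>p\<close>,
  so the quotient fixes \<open>p\<close> and permutes the other three points.\<close>

lemma cyc_quotient:
  assumes "distinct [p, q, m, n]"
  shows "cyc p m q \<circ> cyc q n p = cyc q n m"
  using assms by (auto simp: cyc_def fun_eq_iff)

lemma ex_fresh_nat:
  assumes "finite (A :: nat set)"
  obtains n where "n \<notin> A"
  using assms ex_new_if_finite infinite_UNIV_nat by blast

text \<open>The invariant of the induction along the series. Distinct entries are demanded because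
  only then is \<open>cyc a b c\<close> a 3-cycle.\<close>

definition contains_cycs :: "(nat \<Rightarrow> nat) set \<Rightarrow> bool"
  where "contains_cycs H \<longleftrightarrow> (\<forall>a b c. distinct [a, b, c] \<longrightarrow> cyc a b c \<in> H)"

context
  fixes H N :: "(nat \<Rightarrow> nat) set"
  assumes H: "subgroup H FSym" "contains_cycs H"
    and N: "N \<lhd> (FSym\<lparr>carrier := H\<rparr>)"
begin

interpretation N: normal N "FSym\<lparr>carrier := H\<rparr>" by (rule N)

lemma cyc_mem:
  "distinct [a, b, c] \<Longrightarrow> cyc a b c \<in> H"
  using H(2) by (auto simp: contains_cycs_def)

lemma inv_cyc_in_subgroup:
  assumes "distinct [a, b, c]"
  shows "inv\<^bsub>FSym\<lparr>carrier := H\<rparr>\<^esub> (cyc a b c) = cyc c b a"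
  using assms by (simp add: group.m_inv_consistent[OF group_FSym H(1)] cyc_mem inv_cyc)

lemma normal_cyc_replace:
  assumes "distinct [a, b, c, d]" "cyc a b c \<in> N"
  shows "cyc a d c \<in> N"
proof -
  \<comment> \<open>The transposition of \<open>b\<close> and \<open>d\<close> need not belong to
    \<open>H\<close>; the spare point \<open>e\<close> allows conjugation by a 3-cycle, which
    does.\<close>
  obtain e where e: "e \<notin> {a, b, c, d}"
    using ex_fresh_nat[of "{a, b, c, d}"] by auto
  have "cyc b d e \<circ> cyc a b c \<circ> cyc e d b \<in> N"
    using N.inv_op_closed2[of "cyc b d e" "cyc a b c"] assms e
      inv_cyc_in_subgroup[of b d e] cyc_mem[of b d e]
    by (auto simp: mult_FSym)
  then show ?thesis
    using assms e cyc_conj[of a b c d e] by auto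
qed

lemma contains_cycs_of_abelian_quotient:
  assumes "comm_group ((FSym\<lparr>carrier := H\<rparr>) Mod N)"
  shows "contains_cycs N"
  unfolding contains_cycs_def
proof (intro allI impI)
  fix a b c :: nat assume abc: "distinct [a, b, c]"
  obtain d where d: "d \<notin> {a, b, c}"
    using ex_fresh_nat[of "{a, b, c}"] by auto
  obtain e where e: "e \<notin> {a, b, c, d}"
    using ex_fresh_nat[of "{a, b, c, d}"] by auto
  have "cyc a b d \<circ> cyc a c e \<circ> cyc d b a \<circ> cyc e c a \<in> N"
    using N.commutator_mem_of_comm_group_Mod[OF assms, of "cyc a b d" "cyc a c e"] abc d e
      inv_cyc_in_subgroup[of a b d] inv_cyc_in_subgroup[of a c e] cyc_mem[of a b d] cyc_mem[of a c e]
    by (auto simp: mult_FSym)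
  then show "cyc a b c \<in> N"
    using abc d e cyc_commutator[of a b c d e] by auto
qed

lemma contains_cycs_of_finite_quotient:
  assumes "finite (carrier ((FSym\<lparr>carrier := H\<rparr>) Mod N))"
  shows "contains_cycs N"
  unfolding contains_cycs_def
proof (intro allI impI)
  fix p q r :: nat assume pqr: "distinct [p, q, r]"
  \<comment> \<open>Avoiding \<open>p\<close> and \<open>q\<close> makes \<open>cyc p n q\<close> a
    3-cycle; avoiding \<open>r\<close> keeps the entries distinct when \<open>r\<close> is brought
    in below.\<close>
  have "infinite (- {p, q, r})"
    by (simp add: Compl_eq_Diff_UNIV)
  moreover have "(\<lambda>n. cyc p n q) ` (- {p, q, r}) \<subseteq> carrier (FSym\<lparr>carrier := H\<rparr>)"
    using pqr by (auto intro!: cyc_mem)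
  ultimately obtain m n where mn: "m \<notin> {p, q, r}" "n \<notin> {p, q, r}" "m \<noteq> n"
    and "cyc p m q \<otimes>\<^bsub>FSym\<lparr>carrier := H\<rparr>\<^esub> inv\<^bsub>FSym\<lparr>carrier := H\<rparr>\<^esub> (cyc p n q) \<in> N"
    using N.finite_Mod_imp_quotient_mem[OF assms] by (metis ComplD)
  then have "cyc p m q \<circ> cyc q n p \<in> N"
    using pqr inv_cyc_in_subgroup[of p n q] by (auto simp: mult_FSym)
  then have "cyc q n m \<in> N"
    using pqr mn cyc_quotient[of p q m n] by auto
  \<comment> \<open>Only the middle entry can be replaced: first \<open>n\<close> by
    \<open>r\<close>, then, after a rotation has put \<open>m\<close> in the middle,
    \<open>m\<close> by \<open>p\<close>.\<close>
  then have "cyc q r m \<in> N"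
    using pqr mn normal_cyc_replace[of q n m r] by auto
  then have "cyc r m q \<in> N"
    using pqr mn cyc_rotate[of q r m] by auto
  then have "cyc r p q \<in> N"
    using pqr mn normal_cyc_replace[of r m q p] by auto
  then show "cyc p q r \<in> N"
    using pqr cyc_rotate[of r p q] by auto
qed

end

theorem theorem3p7:
  shows "\<not> interspersed_finite_solvable FSym"
proof
  assume "interspersed_finite_solvable FSym"
  then obtain r S where S: "S 0 = carrier FSym" "S r = {\<one>\<^bsub>FSym\<^esub>}"
    "\<And>k. k \<le> r \<Longrightarrow> subgroup (S k) FSym"
    "\<And>k. k < r \<Longrightarrow> S (Suc k) \<lhd> (FSym\<lparr>carrier := S k\<rparr>)"
    "\<And>k. k < r \<Longrightarrow> comm_group ((FSym\<lparr>carrier := S k\<rparr>) Mod S (Suc k)) \<or>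
         finite (carrier ((FSym\<lparr>carrier := S k\<rparr>) Mod S (Suc k)))"
    unfolding interspersed_finite_solvable_def by blast
  have "contains_cycs (S k)" if "k \<le> r" for k
    using that
  proof (induction k)
    case 0
    show ?case
      using cyc_in_FSym by (auto simp: S(1) contains_cycs_def)
  next
    case (Suc k)
    then have "k < r" "contains_cycs (S k)" by auto
    moreover from \<open>k < r\<close> have "subgroup (S k) FSym"
      by (intro S(3)) simp
    ultimately show ?case
      using S(4,5) contains_cycs_of_abelian_quotient contains_cycs_of_finite_quotient by metis
  qed
  \<comment> \<open>Any 3-cycle contradicts the triviality of the last term; this one sends 0 to
    1.\<close>
  then have "cyc 0 1 2 \<in> S r"
    by (simp add: contains_cycs_def)
  then have "cyc 0 1 2 = (id :: nat \<Rightarrow> nat)"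
    by (simp add: S(2) FSym_def)
  then have "cyc 0 1 2 0 = (0 :: nat)" by simp
  then show False by (simp add: cyc_def)
qed

end
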